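(* Let $K \ge 1$, let $(\mathcal{X}_k, d_k)$, $k = 1, \dots, K$, be metric spaces each of which is a Radon space, let $\mathcal{X} = \mathcal{X}_1 \times \dots \times \mathcal{X}_K$, let $L = (L_1, \dots, L_K)$ with $L_k \ge 0$, let $\mathcal{O} \subseteq \mathcal{X}$ and $z_0 \in \mathcal{X}$, let $G \colon \mathcal{X} \to \mathbb{R}$ be $d_L$-short, and let $m, \theta \in \mathbb{R}$. (1) Let $k \in \{1, \dots, K\}$ and let $(\bar{x}, \bar{y}, \bar{x}', \bar{y}')$ be a maximizer for the diameter problem (D$_k$) with observation set $\mathcal{O}$. If $$|\bar{y} - G(z_0)| \le d_L(\bar{x}, z_0) \quad \text{and} \quad |\bar{y}' - G(z_0)| \le d_L(\bar{x}', z_0),$$ then $z_0$ is non-binding for $\widehat{D}_k$ with respect to $\mathcal{O}$, i.e. $\widehat{D}_k[\mathcal{O} \cup \{z_0\}] = \widehat{D}_k[\mathcal{O}]$. (2) Let $(\bar{x}_0, \bar{x}_1, \bar{y}, \bar{p})$ be a maximizer for the probability problem (P) with observation set $\mathcal{O}$. If $$|\bar{y}_\varepsilon - G(z_0)| \le d_L(\bar{x}_\varepsilon, z_0) \quad \text{for all } \varepsilon \in \{0,1\}^K,$$ then $z_0$ is non-binding for $\widehat{P}$ with respect to $\mathcal{O}$, i.e. $\widehat{P}[\mathcal{O} \cup \{z_0\}] = \widehat{P}[\mathcal{O}]$.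
   Context: Points of $\mathcal{X}$ are written $x = (x^1, \dots, x^K)$. Define $d_L(x, x') := \sum_{k=1}^K L_k d_k(x^k, x'^k)$. A function is $d_L$-short if $|f(x) - f(x')| \le d_L(x, x')$ for all $x, x'$ in its domain. A topological space is a Radon space if it is separable and every Borel probability measure on it is inner regular with respect to compact sets. Diameter problem (D$_k$) with observation set $\mathcal{O}$: maximize $|y - y'|$ among $(x, y), (x', y') \in \mathcal{X} \times \mathbb{R}$ subject to: $x^i = x'^i$ for all $i \ne k$; $|y - y'| \le L_k d_k(x^k, x'^k)$; and, for all $z \in \mathcal{O}$, $|y - G(z)| \le d_L(x, z)$ and $|y' - G(z)| \le d_L(x', z)$. Its optimal value (supremum) is $\widehat{D}_k[\mathcal{O}]$. For $x_0, x_1 \in \mathcal{X}$ and $\varepsilon \in \{0,1\}^K$, let $x_\varepsilon := (x_{\varepsilon_k}^k)_{k=1}^K$ (the $k$-th component is that of $x_0$ if $\varepsilon_k = 0$ and that of $x_1$ if $\varepsilon_k = 1$). For $p \in [0,1]^K$, let $w_\varepsilon(p) := \prod_{k=1}^K p_k^{1 - \varepsilon_k} (1 - p_k)^{\varepsilon_k}$ (with $0^0 = 1$). Probability problem (P) with observation set $\mathcal{O}$: maximize $\sum_{\varepsilon \in \{0,1\}^K} w_\varepsilon(p)\, \mathbf{1}[y_\varepsilon \le \theta]$ among $x_0, x_1 \in \mathcal{X}$, $y \colon \{0,1\}^K \to \mathbb{R}$, $p \in [0,1]^K$ subject to: $|y_\varepsilon - y_{\varepsilon'}| \le d_L(x_\varepsilon,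 x_{\varepsilon'})$ for all $\varepsilon \ne \varepsilon'$; $|y_\varepsilon - G(z)| \le d_L(x_\varepsilon, z)$ for all $\varepsilon$ and all $z \in \mathcal{O}$; and $\sum_{\varepsilon} w_\varepsilon(p)\, y_\varepsilon \ge m$. $\widehat{P}[\mathcal{O}]$ is the supremum of $\mu[g \le \theta]$ over all pairs $(g, \mu)$ with $g \colon \mathcal{X} \to \mathbb{R}$ $d_L$-short, $g = G$ on $\mathcal{O}$, $\mu = \mu_1 \otimes \dots \otimes \mu_K$ a product of Borel probability measures $\mu_k$ on $\mathcal{X}_k$, $g$ $\mu$-integrable and $\mathbb{E}_\mu[g] \ge m$; when every $\mathcal{X}_k$ is a Radon space, $\widehat{P}[\mathcal{O}]$ equals the optimal value (supremum) of problem (P) with observation set $\mathcal{O}$, and this equality may be used. *)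

theory Defs
  imports "HOL-Probability.Probability"
begin

(* The spaces X_1, ..., X_K are given as a family X :: nat => 'a metric, whose carriers mspace (X k)
   are arbitrary subsets of a common type; this loses no generality, since 'a may be taken to be the
   disjoint union of the carriers. Only the indices in {1..K} matter. *)

definition prod_space :: "nat \<Rightarrow> (nat \<Rightarrow> 'a metric) \<Rightarrow> (nat \<Rightarrow> 'a) set" where
  "prod_space K X = (\<Pi>\<^sub>E k\<in>{1..K}. mspace (X k))"

definition dL :: "nat \<Rightarrow> (nat \<Rightarrow> 'a metric) \<Rightarrow> (nat \<Rightarrow> real) \<Rightarrow> (nat \<Rightarrow> 'a) \<Rightarrow> (nat \<Rightarrow> 'a) \<Rightarrow> real" where
  "dL K X L x x' = (\<Sum>k=1..K. L k * mdist (X k) (x k) (x' k))"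

definition dL_short :: "nat \<Rightarrow> (nat \<Rightarrow> 'a metric) \<Rightarrow> (nat \<Rightarrow> real) \<Rightarrow> ((nat \<Rightarrow> 'a) \<Rightarrow> real) \<Rightarrow> bool" where
  "dL_short K X L f \<longleftrightarrow>
     (\<forall>x\<in>prod_space K X. \<forall>x'\<in>prod_space K X. \<bar>f x - f x'\<bar> \<le> dL K X L x x')"

definition borel_of :: "'a topology \<Rightarrow> 'a measure" where
  "borel_of T = sigma (topspace T) {U. openin T U}"

definition borel_prob_measure :: "'a topology \<Rightarrow> 'a measure \<Rightarrow> bool" where
  "borel_prob_measure T \<mu> \<longleftrightarrow> prob_space \<mu> \<and> sets \<mu> = sets (borel_of T)"

definition Radon_space :: "'a topology \<Rightarrow> bool" where
  "Radon_space T \<longleftrightarrow> separable_space T \<and>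
     (\<forall>\<mu>. borel_prob_measure T \<mu> \<longrightarrow>
        (\<forall>A\<in>sets \<mu>. emeasure \<mu> A = (SUP C\<in>{C. compactin T C \<and> C \<subseteq> A}. emeasure \<mu> C)))"

definition diam_feasible ::
  "nat \<Rightarrow> (nat \<Rightarrow> 'a metric) \<Rightarrow> (nat \<Rightarrow> real) \<Rightarrow> ((nat \<Rightarrow> 'a) \<Rightarrow> real) \<Rightarrow> nat \<Rightarrow> (nat \<Rightarrow> 'a) set
     \<Rightarrow> ((nat \<Rightarrow> 'a) \<times> real \<times> (nat \<Rightarrow> 'a) \<times> real) set" where
  "diam_feasible K X L G k Obs =
     {(x, y, x', y'). x \<in> prod_space K X \<and> x' \<in> prod_space K X \<and>
        (\<forall>i\<in>{1..K}. i \<noteq> k \<longrightarrow> x i = x' i) \<and>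
        \<bar>y - y'\<bar> \<le> L k * mdist (X k) (x k) (x' k) \<and>
        (\<forall>z\<in>Obs. \<bar>y - G z\<bar> \<le> dL K X L x z \<and> \<bar>y' - G z\<bar> \<le> dL K X L x' z)}"

definition diam_objective :: "(nat \<Rightarrow> 'a) \<times> real \<times> (nat \<Rightarrow> 'a) \<times> real \<Rightarrow> real" where
  "diam_objective = (\<lambda>(x, y, x', y'). \<bar>y - y'\<bar>)"

(* The supremum may be infinite, hence ereal. *)
definition Dhat ::
  "nat \<Rightarrow> (nat \<Rightarrow> 'a metric) \<Rightarrow> (nat \<Rightarrow> real) \<Rightarrow> ((nat \<Rightarrow> 'a) \<Rightarrow> real) \<Rightarrow> nat \<Rightarrow> (nat \<Rightarrow> 'a) set \<Rightarrow> ereal" where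
  "Dhat K X L G k Obs = (SUP q\<in>diam_feasible K X L G k Obs. ereal (diam_objective q))"

definition cube :: "nat \<Rightarrow> (nat \<Rightarrow> nat) set" where
  "cube K = (\<Pi>\<^sub>E k\<in>{1..K}. {0, 1})"

definition vertex :: "nat \<Rightarrow> (nat \<Rightarrow> 'a) \<Rightarrow> (nat \<Rightarrow> 'a) \<Rightarrow> (nat \<Rightarrow> nat) \<Rightarrow> (nat \<Rightarrow> 'a)" where
  "vertex K x0 x1 \<epsilon> = (\<lambda>k\<in>{1..K}. if \<epsilon> k = 0 then x0 k else x1 k)"

definition weight :: "nat \<Rightarrow> (nat \<Rightarrow> real) \<Rightarrow> (nat \<Rightarrow> nat) \<Rightarrow> real" where
  "weight K p \<epsilon> = (\<Prod>k=1..K. p k ^ (1 - \<epsilon> k) * (1 - p k) ^ \<epsilon> k)"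

(* The values y_\<epsilon> form a function y on all of nat => nat, of which only the restriction
   to cube K is ever used. *)
definition prob_feasible ::
  "nat \<Rightarrow> (nat \<Rightarrow> 'a metric) \<Rightarrow> (nat \<Rightarrow> real) \<Rightarrow> ((nat \<Rightarrow> 'a) \<Rightarrow> real) \<Rightarrow> real \<Rightarrow> (nat \<Rightarrow> 'a) set
     \<Rightarrow> ((nat \<Rightarrow> 'a) \<times> (nat \<Rightarrow> 'a) \<times> ((nat \<Rightarrow> nat) \<Rightarrow> real) \<times> (nat \<Rightarrow> real)) set" where
  "prob_feasible K X L G m Obs =
     {(x0, x1, y, p). x0 \<in> prod_space K X \<and> x1 \<in> prod_space K X \<and> p \<in> (\<Pi>\<^sub>E k\<in>{1..K}. {0..1}) \<and>
        (\<forall>\<epsilon>\<in>cube K. \<forall>\<epsilon>'\<in>cube K. \<epsilon> \<noteq> \<epsilon>' \<longrightarrow>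
           \<bar>y \<epsilon> - y \<epsilon>'\<bar> \<le> dL K X L (vertex K x0 x1 \<epsilon>) (vertex K x0 x1 \<epsilon>')) \<and>
        (\<forall>\<epsilon>\<in>cube K. \<forall>z\<in>Obs. \<bar>y \<epsilon> - G z\<bar> \<le> dL K X L (vertex K x0 x1 \<epsilon>) z) \<and>
        (\<Sum>\<epsilon>\<in>cube K. weight K p \<epsilon> * y \<epsilon>) \<ge> m}"

definition prob_objective ::
  "nat \<Rightarrow> real \<Rightarrow> (nat \<Rightarrow> 'a) \<times> (nat \<Rightarrow> 'a) \<times> ((nat \<Rightarrow> nat) \<Rightarrow> real) \<times> (nat \<Rightarrow> real) \<Rightarrow> real" where
  "prob_objective K \<theta> = (\<lambda>(x0, x1, y, p). \<Sum>\<epsilon>\<in>cube K. weight K p \<epsilon> * (if y \<epsilon> \<le> \<theta> then 1 else 0))"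

(* Separable factors make the product \<sigma>-algebra of PiM the Borel \<sigma>-algebra of the product.
   Only the values of g on prod_space K X matter. *)
definition Phat_admissible ::
  "nat \<Rightarrow> (nat \<Rightarrow> 'a metric) \<Rightarrow> (nat \<Rightarrow> real) \<Rightarrow> ((nat \<Rightarrow> 'a) \<Rightarrow> real) \<Rightarrow> real \<Rightarrow> (nat \<Rightarrow> 'a) set
     \<Rightarrow> (((nat \<Rightarrow> 'a) \<Rightarrow> real) \<times> (nat \<Rightarrow> 'a measure)) set" where
  "Phat_admissible K X L G m Obs =
     {(g, \<mu>). dL_short K X L g \<and> (\<forall>z\<in>Obs. g z = G z) \<and>
        (\<forall>k\<in>{1..K}. borel_prob_measure (mtopology_of (X k)) (\<mu> k)) \<and>
        integrable (PiM {1..K} \<mu>) g \<and> (\<integral>x. g x \<partial>PiM {1..K} \<mu>) \<ge> m}"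

(* In ereal, the supremum over an empty admissible set is -\<infinity>. *)
definition Phat ::
  "nat \<Rightarrow> (nat \<Rightarrow> 'a metric) \<Rightarrow> (nat \<Rightarrow> real) \<Rightarrow> ((nat \<Rightarrow> 'a) \<Rightarrow> real) \<Rightarrow> real \<Rightarrow> real \<Rightarrow> (nat \<Rightarrow> 'a) set \<Rightarrow> ereal" where
  "Phat K X L G m \<theta> Obs =
     (SUP (g, \<mu>)\<in>Phat_admissible K X L G m Obs.
        ereal (measure (PiM {1..K} \<mu>) {x \<in> space (PiM {1..K} \<mu>). g x \<le> \<theta>}))"

end

theory Submission
  imports Defs
begin

text \<open>
  A maximizer for \<open>Obs\<close> that lies in the smaller feasible set of \<open>Obs \<union> {z0}\<close> forces the two
  suprema to agree. For the diameter problem this is all; for the probability problem one also needs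
  that \<open>Phat\<close> is the optimal value of the finite-dimensional problem.

  A feasible point yields an admissible pair: extend \<open>G\<close> on \<open>Obs\<close> and the values \<open>y \<epsilon>\<close> at the
  vertices to a short function (McShane) and take the product of the two-point measures
  \<open>p k \<delta>(x0 k) + (1 - p k) \<delta>(x1 k)\<close>.

  Conversely, given an admissible pair, freeze all factors of \<open>\<mu>\<close> but one. By Fubini, the mean of
  \<open>g\<close> and the probability of \<open>g \<le> \<theta>\<close> are means of two real functions of the remaining coordinate,
  so the pair of them lies in a planar convex hull and is dominated by a convex combination of two
  points. Hence that factor can be replaced by a two-point measure without decreasing either
  quantity; iterating over the coordinates gives a feasible point.
  Separability makes short functions measurable for the product \<open>\<sigma>\<close>-algebra.
\<close>

section \<open>Short functions\<close>

lemma dL_nonneg: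
  assumes "\<forall>k\<in>{1..K}. L k \<ge> 0"
  shows "0 \<le> dL K X L x y"
  unfolding dL_def using assms by (intro sum_nonneg mult_nonneg_nonneg) auto

lemma dL_commute: "dL K X L x y = dL K X L y x"
  by (simp add: dL_def mdist_commute)

lemma dL_self:
  assumes "x \<in> prod_space K X"
  shows "dL K X L x x = 0"
  using assms by (auto simp: dL_def prod_space_def PiE_iff intro!: sum.neutral)

lemma dL_triangle:
  assumes "\<forall>k\<in>{1..K}. L k \<ge> 0"
    and "x \<in> prod_space K X" "y \<in> prod_space K X" "z \<in> prod_space K X"
  shows "dL K X L x z \<le> dL K X L x y + dL K X L y z"
proof -
  have "L k * mdist (X k) (x k) (z k) \<le> L k * mdist (X k) (x k) (y k) + L k * mdist (X k) (y k) (z k)"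
    if "k \<in> {1..K}" for k
    using that assms mdist_triangle[of "x k" "X k" "y k" "z k"]
    unfolding distrib_left[symmetric] by (intro mult_left_mono) (auto simp: prod_space_def PiE_iff)
  then show ?thesis
    unfolding dL_def sum.distrib[symmetric] by (rule sum_mono)
qed

text \<open>The infimum of the cones \<open>v + dL K X L x s\<close> over the nodes is short by the
  triangle inequality, and compatibility keeps each cone above the prescribed values.
  \<open>J\<close> is a relation, so a point may be listed repeatedly; \<open>compat\<close> in both
  orders then forces equal values.\<close>

lemma McShane_extension:
  assumes L: "\<forall>k\<in>{1..K}. L k \<ge> 0"
    and "J \<noteq> {}"
    and J: "\<And>s v. (s, v) \<in> J \<Longrightarrow> s \<in> prod_space K X"
    and compat: "\<And>s v t w. (s, v) \<in> J \<Longrightarrow> (t, w) \<in> J \<Longrightarrow> v - w \<le> dL K X L s t"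
  shows "\<exists>g. dL_short K X L g \<and> (\<forall>(s, v)\<in>J. g s = v)"
proof (intro exI conjI ballI)
  define g where "g x = (INF (s, v)\<in>J. v + dL K X L x s)" for x
  have bdd: "bdd_below ((\<lambda>(s, v). v + dL K X L x s) ` J)" if x: "x \<in> prod_space K X" for x
  proof -
    obtain t w where tw: "(t, w) \<in> J" using \<open>J \<noteq> {}\<close> by auto
    have "w - dL K X L t x \<le> v + dL K X L x s" if "(s, v) \<in> J" for s v
      using compat[OF tw that] dL_triangle[OF L J[OF tw] x J[OF that]] by linarith
    then show ?thesis by (intro bdd_belowI[of _ "w - dL K X L t x"]) auto
  qed
  have lower: "g x \<le> v + dL K X L x s" if "x \<in> prod_space K X" "(s, v) \<in> J" for x s v
    unfolding g_def using cINF_lower[OF bdd[OF that(1)] that(2)] by simp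
  have greatest: "c \<le> g x" if "\<And>s v. (s, v) \<in> J \<Longrightarrow> c \<le> v + dL K X L x s" for c x
    unfolding g_def using \<open>J \<noteq> {}\<close> that by (intro cINF_greatest) auto
  have "g x \<le> g y + dL K X L x y" if x: "x \<in> prod_space K X" and y: "y \<in> prod_space K X" for x y
  proof -
    have "g x - dL K X L x y \<le> v + dL K X L y s" if "(s, v) \<in> J" for s v
      using lower[OF x that] dL_triangle[OF L x y J[OF that]] by linarith
    from greatest[of "g x - dL K X L x y" y, OF this] show ?thesis by linarith
  qed
  then show "dL_short K X L g"
    unfolding dL_short_def by (smt (verit) dL_commute)
  have "g s = v" if sv: "(s, v) \<in> J" for s v
  proof (rule antisym)
    show "g s \<le> v" using lower[OF J[OF sv] sv] by (simp add: dL_self J[OF sv])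
    show "v \<le> g s" using compat[OF sv] by (intro greatest) (simp add: algebra_simps)
  qed
  then show "case q of (s, v) \<Rightarrow> g s = v" if "q \<in> J" for q using that by auto
qed

section \<open>Borel measurability of short functions\<close>

lemma space_borel_of [simp]: "space (borel_of T) = topspace T"
  unfolding borel_of_def by (rule space_measure_of) (auto dest: openin_subset)

lemma sets_borel_of: "sets (borel_of T) = sigma_sets (topspace T) {U. openin T U}"
  unfolding borel_of_def by (rule sets_measure_of) (auto dest: openin_subset)

lemma borel_measurable_mdist:
  assumes "d \<in> mspace m"
  shows "(\<lambda>x. mdist m x d) \<in> borel_measurable (borel_of (mtopology_of m))"
proof (rule borel_measurableI)
  fix S :: "real set" assume "open S"
  moreover have "continuous_map (mtopology_of m) euclideanreal (\<lambda>x. mdist m x d)"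
    using assms by (intro continuous_map_mdist) auto
  ultimately have "openin (mtopology_of m) {x \<in> topspace (mtopology_of m). mdist m x d \<in> S}"
    by (intro openin_continuous_map_preimage) auto
  moreover have "{x \<in> topspace (mtopology_of m). mdist m x d \<in> S} =
      (\<lambda>x. mdist m x d) -` S \<inter> space (borel_of (mtopology_of m))"
    by auto
  ultimately show "(\<lambda>x. mdist m x d) -` S \<inter> space (borel_of (mtopology_of m))
      \<in> sets (borel_of (mtopology_of m))"
    by (simp add: sets_borel_of sigma_sets.Basic)
qed

text \<open>An error below \<open>\<delta>\<close> in each of the finitely many coordinates costs at
  most \<open>sum L {1..K} * \<delta>\<close> in total.\<close>

lemma dL_dense:
  assumes L: "\<forall>k\<in>{1..K}. L k \<ge> 0"
    and C: "\<forall>k\<in>{1..K}. mtopology_of (X k) closure_of C k = mspace (X k)"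
    and x: "x \<in> prod_space K X" and "e > 0"
  obtains d where "d \<in> (\<Pi>\<^sub>E k\<in>{1..K}. C k)" "dL K X L x d < e"
proof -
  \<comment> \<open>The \<open>+ 1\<close> keeps the denominator positive when all
    \<open>L k\<close> vanish and makes the final bound strict.\<close>
  define \<delta> where "\<delta> = e / (sum L {1..K} + 1)"
  have pos: "sum L {1..K} \<ge> 0" using L by (auto intro: sum_nonneg)
  then have \<delta>: "\<delta> > 0" using \<open>e > 0\<close> by (simp add: \<delta>_def)
  have "\<exists>c\<in>C k. mdist (X k) (x k) c < \<delta>" if "k \<in> {1..K}" for k
  proof -
    interpret Metric_space "mspace (X k)" "mdist (X k)" by simp
    have "x k \<in> mtopology closure_of C k"
      using x that C by (auto simp: prod_space_def mtopology_of_def)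
    with \<delta> show ?thesis by (auto simp: metric_closure_of)
  qed
  then obtain c where c: "\<And>k. k \<in> {1..K} \<Longrightarrow> c k \<in> C k \<and> mdist (X k) (x k) (c k) < \<delta>"
    by metis
  show ?thesis
  proof
    show "restrict c {1..K} \<in> (\<Pi>\<^sub>E k\<in>{1..K}. C k)" using c by auto
    have "dL K X L x (restrict c {1..K}) \<le> (\<Sum>k=1..K. L k * \<delta>)"
      unfolding dL_def using c L by (intro sum_mono mult_left_mono) (auto intro: less_imp_le)
    also have "\<dots> = sum L {1..K} * \<delta>" by (simp add: sum_distrib_right)
    also have "\<dots> < e" using pos \<open>e > 0\<close> by (simp add: \<delta>_def field_simps)
    finally show "dL K X L x (restrict c {1..K}) < e" .
  qed
qed

text \<open>Over a countable dense set of nodes, a short function is its own McShane extension, hence a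
  countable infimum of measurable functions.\<close>

lemma dL_short_measurable:
  assumes L: "\<forall>k\<in>{1..K}. L k \<ge> 0"
    and sep: "\<forall>k\<in>{1..K}. separable_space (mtopology_of (X k))"
    and g: "dL_short K X L g"
  shows "g \<in> borel_measurable (PiM {1..K} (\<lambda>k. borel_of (mtopology_of (X k))))"
proof -
  let ?M = "PiM {1..K} (\<lambda>k. borel_of (mtopology_of (X k)))"
  have space: "space ?M = prod_space K X"
    by (simp add: space_PiM prod_space_def)
  from sep obtain C where C: "\<And>k. k \<in> {1..K} \<Longrightarrow> countable (C k)"
      "\<And>k. k \<in> {1..K} \<Longrightarrow> C k \<subseteq> mspace (X k)"
      "\<forall>k\<in>{1..K}. mtopology_of (X k) closure_of C k = mspace (X k)"
    unfolding separable_space_def topspace_mtopology_of by metis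
  define D where "D = (\<Pi>\<^sub>E k\<in>{1..K}. C k)"
  have "countable D" unfolding D_def using C(1) by (intro countable_PiE) auto
  have D: "D \<subseteq> prod_space K X" unfolding D_def prod_space_def using C(2) by (intro PiE_mono)
  have "(\<lambda>x. INF d\<in>D. g d + dL K X L x d) \<in> borel_measurable ?M"
  proof (rule borel_measurable_cINF_real[OF \<open>countable D\<close>])
    fix d assume "d \<in> D"
    then have d: "d k \<in> mspace (X k)" if "k \<in> {1..K}" for k
      using D that unfolding prod_space_def by blast
    have "(\<lambda>x. mdist (X k) (x k) (d k)) \<in> borel_measurable ?M" if "k \<in> {1..K}" for k
      using measurable_component_singleton[OF that] borel_measurable_mdist[OF d[OF that]]
      by (rule measurable_compose)
    then show "(\<lambda>x. g d + dL K X L x d) \<in> borel_measurable ?M"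
      unfolding dL_def
      by (intro borel_measurable_add borel_measurable_const borel_measurable_sum borel_measurable_times)
  qed
  moreover have "(INF d\<in>D. g d + dL K X L x d) = g x" if x: "x \<in> prod_space K X" for x
  proof (rule antisym)
    obtain d0 where "d0 \<in> D" using dL_dense[OF L C(3) x zero_less_one] by (auto simp: D_def)
    have le: "g x \<le> g d + dL K X L x d" if "d \<in> D" for d
      using g x D that unfolding dL_short_def by (smt (verit) subsetD)
    then show "g x \<le> (INF d\<in>D. g d + dL K X L x d)"
      using \<open>d0 \<in> D\<close> by (intro cINF_greatest) auto
    show "(INF d\<in>D. g d + dL K X L x d) \<le> g x"
    proof (rule field_le_epsilon)
      fix e :: real assume "e > 0"
      \<comment> \<open>Half of \<open>e\<close>, since \<open>dL K X L x d\<close> enters twice: in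
        the cone at \<open>d\<close> and in comparing \<open>g d\<close> with
        \<open>g x\<close>.\<close>
      then obtain d where d: "d \<in> D" "dL K X L x d < e / 2"
        using dL_dense[OF L C(3) x, of "e / 2"] by (auto simp: D_def)
      have "(INF d\<in>D. g d + dL K X L x d) \<le> g d + dL K X L x d"
        using le d(1) by (intro cINF_lower bdd_belowI[of _ "g x"]) auto
      also have "\<bar>g x - g d\<bar> \<le> dL K X L x d"
        using g x D d(1) by (auto simp: dL_short_def)
      then have "g d + dL K X L x d \<le> g x + e" using d(2) by linarith
      finally show "(INF d\<in>D. g d + dL K X L x d) \<le> g x + e" .
    qed
  qed
  ultimately show ?thesis
    using measurable_cong[of ?M "\<lambda>x. INF d\<in>D. g d + dL K X L x d" g borel] unfolding space by blast
qed

section \<open>Domination of a pair of means by two points\<close>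

text \<open>The mean of \<open>(f, h)\<close> lies in the convex hull of its range, and a point of a planar convex hull
  is dominated by one on an edge. The supporting line of slope \<open>s\<close> makes this elementary.\<close>

lemma (in prob_space) two_point_domination:
  fixes f h :: "'a \<Rightarrow> real"
  assumes f [simp]: "integrable M f" and h [simp]: "integrable M h"
  obtains p u v where "p \<in> {0..1}" "u \<in> space M" "v \<in> space M"
    "expectation f \<le> p * f u + (1 - p) * f v" "expectation h \<le> p * h u + (1 - p) * h v"
proof -
  define a where "a x = f x - expectation f" for x
  define b where "b x = h x - expectation h" for x
  have int [simp]: "integrable M a" "integrable M b" unfolding a_def b_def by auto
  have mean: "expectation a = 0" "expectation b = 0"
    unfolding a_def b_def by (simp_all add: prob_space)
  have "\<exists>p u v. p \<in> {0..1} \<and> u \<in> space M \<and> v \<in> space M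
      \<and> 0 \<le> p * a u + (1 - p) * a v \<and> 0 \<le> p * b u + (1 - p) * b v"
  \<comment> \<open>After centring, some segment between values of \<open>(a, b)\<close> has to meet
    the closed first quadrant. If none does, all values lie on one side of a line through the
    origin, and mean zero puts almost all of them on that line.\<close>
  proof (rule ccontr)
    assume "\<nexists>p u v. p \<in> {0..1} \<and> u \<in> space M \<and> v \<in> space M
      \<and> 0 \<le> p * a u + (1 - p) * a v \<and> 0 \<le> p * b u + (1 - p) * b v"
    then have neg: False if "p \<in> {0..1}" "u \<in> space M" "v \<in> space M"
        "0 \<le> p * a u + (1 - p) * a v" "0 \<le> p * b u + (1 - p) * b v" for p u v
      using that by blast
    have one: "a x < 0 \<or> b x < 0" if "x \<in> space M" for x
      using neg[of 1 x x] that by force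
    have two: "a u * b v < a v * b u"
      if u: "u \<in> space M" "0 < a u" and v: "v \<in> space M" "0 < b v" for u v
    proof (rule ccontr)
      assume less: "\<not> a u * b v < a v * b u"
      have "a v < 0" using one v by force
      \<comment> \<open>This \<open>p\<close> makes the first coordinate of the combination vanish;
        the second then has the sign of \<open>a u * b v - a v * b u\<close>, as
        \<open>a u - a v\<close> is positive.\<close>
      define p where "p = - a v / (a u - a v)"
      have p: "p \<in> {0..1}" "1 - p = a u / (a u - a v)"
        using u(2) \<open>a v < 0\<close> by (auto simp: p_def field_simps)
      have "p * a u + (1 - p) * a v = 0"
        unfolding p(2) by (simp add: p_def field_simps)
      moreover have "p * b u + (1 - p) * b v = (a u * b v - a v * b u) / (a u - a v)"
        unfolding p(2) by (simp add: p_def diff_divide_distrib)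
      then have "0 \<le> p * b u + (1 - p) * b v"
        using less u(2) \<open>a v < 0\<close> by simp
      ultimately show False using neg[OF p(1) u(1) v(1)] by simp
    qed
    define U where "U = {x \<in> space M. 0 < a x}"
    define V where "V = {x \<in> space M. 0 < b x}"
    have bU: "b u < 0" if "u \<in> U" for u using one that by (force simp: U_def)
    have aV: "a v < 0" if "v \<in> V" for v using one that by (force simp: V_def)
    \<comment> \<open>Mean zero without positive values means zero almost everywhere, so
      \<open>d\<close> would be negative almost everywhere although its mean is zero. Generic
      \<open>c\<close> and \<open>d\<close> serve both orders of \<open>a\<close> and
      \<open>b\<close>.\<close>
    have nonempty: "\<exists>x\<in>space M. 0 < c x"
      if c: "integrable M c" "expectation c = 0" "integrable M d" "expectation d = 0"
        and cd: "\<And>x. x \<in> space M \<Longrightarrow> c x < 0 \<or> d x < 0" for c d :: "'a \<Rightarrow> real"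
    proof (rule ccontr)
      assume "\<not> (\<exists>x\<in>space M. 0 < c x)"
      then have le: "c x \<le> 0" if "x \<in> space M" for x using that by force
      have "(AE x in M. - c x = 0)"
        using c le by (subst integral_nonneg_eq_0_iff_AE[symmetric]) auto
      then have "AE x in M. d x < 0" using AE_space by eventually_elim (use cd in force)
      then show False using expectation_less[OF c(3), of 0] c(4) by simp
    qed
    have "U \<noteq> {}" using nonempty[OF int(1) mean(1) int(2) mean(2) one] by (auto simp: U_def)
    have "V \<noteq> {}" using nonempty[OF int(2) mean(2) int(1) mean(1)] one by (auto simp: V_def)
    then obtain v0 where v0: "v0 \<in> V" by auto
    have ratio: "a u / - b u < - a v / b v" if "u \<in> U" "v \<in> V" for u v
      using two[of u v] that bU[OF that(1)]
      by (auto simp: U_def V_def field_simps)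
    \<comment> \<open>By \<open>ratio\<close>, the quotients from \<open>U\<close> lie below those
      from \<open>V\<close>. The supremum \<open>s\<close> separates the two families, which is the
      inequality \<open>a + s * b \<le> 0\<close> on both sets.\<close>
    define s where "s = (SUP u\<in>U. a u / - b u)"
    have bdd: "bdd_above ((\<lambda>u. a u / - b u) ` U)"
      using ratio[OF _ v0] by (intro bdd_aboveI[of _ "- a v0 / b v0"]) (auto intro: less_imp_le)
    have sU: "a u / - b u \<le> s" if "u \<in> U" for u
      unfolding s_def by (rule cSUP_upper[OF that bdd])
    have sV: "s \<le> - a v / b v" if "v \<in> V" for v
      unfolding s_def using ratio[OF _ that] \<open>U \<noteq> {}\<close> by (intro cSUP_least) (auto intro: less_imp_le)
    have lineU: "a u + s * b u \<le> 0" if "u \<in> U" for u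
      using sU[OF that] bU[OF that] by (simp add: field_simps)
    have lineV: "a v + s * b v \<le> 0" if "v \<in> V" for v
      using sV[OF that] that by (simp add: V_def field_simps)
    obtain u0 where u0: "u0 \<in> U" using \<open>U \<noteq> {}\<close> by auto
    have "0 < s" using sU[OF u0] u0 bU[OF u0] by (smt (verit) U_def divide_pos_pos mem_Collect_eq)
    have line: "a x + s * b x \<le> 0" if "x \<in> space M" for x
    proof (cases "x \<in> U \<or> x \<in> V")
      case True
      then show ?thesis using lineU lineV by auto
    next
      case False
      then have "a x \<le> 0" "b x \<le> 0" using that by (auto simp: U_def V_def)
      then show ?thesis using \<open>0 < s\<close> by (simp add: add_nonpos_nonpos mult_nonneg_nonpos)
    qed
    \<comment> \<open>A nonpositive function of mean zero vanishes almost everywhere.\<close>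
    have "(AE x in M. - (a x + s * b x) = 0)"
    proof (subst integral_nonneg_eq_0_iff_AE[symmetric])
      show "AE x in M. 0 \<le> - (a x + s * b x)"
        using line by (intro AE_I2) force
    qed (use mean in auto)
    then have ae: "AE x in M. x \<in> space M \<and> a x = - s * b x"
      using AE_space by eventually_elim auto
    \<comment> \<open>By strictness in \<open>two\<close>, \<open>U\<close> and \<open>V\<close>
      cannot both meet the line \<open>a + s * b = 0\<close>. If \<open>U\<close> meets it,
      \<open>V\<close> does not and \<open>b\<close> is negative almost everywhere; otherwise
      \<open>a\<close> is. Either contradicts mean zero.\<close>
    consider u where "u \<in> U" "a u + s * b u = 0" | "\<And>u. u \<in> U \<Longrightarrow> a u + s * b u \<noteq> 0" by auto
    then show False
    proof cases
      case 1
      have off_line: "a v + s * b v \<noteq> 0" if "v \<in> V" for v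
      proof
        assume "a v + s * b v = 0"
        then have "a u = - s * b u" "a v = - s * b v" using 1(2) by auto
        then show False using two[of u v] 1(1) that by (simp add: U_def V_def)
      qed
      have b_neg: "b x < 0" if "x \<in> space M" "a x = - s * b x" for x
      proof (rule ccontr)
        assume "\<not> b x < 0"
        moreover from this have "0 < s * b x" using that one[OF that(1)] by auto
        ultimately have "x \<in> V" using that(1) \<open>0 < s\<close> by (simp add: V_def zero_less_mult_iff)
        then show False using off_line that(2) by force
      qed
      have "AE x in M. b x < 0" using ae by eventually_elim (use b_neg in blast)
      then show False using expectation_less[OF int(2), of 0] mean by simp
    next
      case 2
      have a_neg: "a x < 0" if "x \<in> space M" "a x = - s * b x" for x
      proof (rule ccontr)
        assume "\<not> a x < 0"
        moreover from this have "s * b x < 0"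
          using one[OF that(1)] \<open>0 < s\<close> by (simp add: mult_pos_neg)
        ultimately have "x \<in> U" using that by (simp add: U_def)
        then show False using 2 that(2) by force
      qed
      have "AE x in M. a x < 0" using ae by eventually_elim (use a_neg in blast)
      then show False using expectation_less[OF int(1), of 0] mean by simp
    qed
  qed
  then obtain p u v where "p \<in> {0..1}" "u \<in> space M" "v \<in> space M"
    "0 \<le> p * a u + (1 - p) * a v" "0 \<le> p * b u + (1 - p) * b v" by blast
  then show thesis by (intro that[of p u v]) (auto simp: a_def b_def algebra_simps)
qed

section \<open>Products of two-point measures\<close>

text \<open>Success is sent to \<open>0\<close>, so that \<open>p\<close> is the mass of
  \<open>0\<close>, as in \<open>weight\<close>.\<close>

definition coin :: "real \<Rightarrow> nat pmf" where
  "coin p = map_pmf (\<lambda>b. if b then 0 else 1) (bernoulli_pmf p)"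

text \<open>For \<open>p\<close> in \<open>{0..1}\<close> this is
  \<open>p \<delta>_u + (1 - p) \<delta>_v\<close> on the \<sigma>-algebra of \<open>N\<close>. As
  an image of a coin it covers \<open>u = v\<close> as well, and products of such measures become
  images of products of coins.\<close>

definition two_point :: "'a measure \<Rightarrow> real \<Rightarrow> 'a \<Rightarrow> 'a \<Rightarrow> 'a measure" where
  "two_point N p u v = distr (measure_pmf (coin p)) N (\<lambda>e. if e = 0 then u else v)"

lemma pmf_coin:
  assumes "p \<in> {0..1}"
  shows "pmf (coin p) e = (if e = 0 then p else if e = 1 then 1 - p else 0)"
proof -
  have "(\<lambda>b. if b then 0 else 1::nat) -` {e} = (if e = 0 then {True} else if e = 1 then {False} else {})"
    by (auto split: if_splits)
  then show ?thesis using assms by (simp add: coin_def pmf_map measure_pmf_single)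
qed

lemma set_pmf_coin: "set_pmf (coin p) \<subseteq> {0, 1}"
  by (auto simp: coin_def)

lemma sets_two_point [simp, measurable_cong]: "sets (two_point N p u v) = sets N"
  and space_two_point [simp]: "space (two_point N p u v) = space N"
  by (simp_all add: two_point_def)

lemma prob_space_two_point:
  assumes "u \<in> space N" "v \<in> space N"
  shows "prob_space (two_point N p u v)"
  unfolding two_point_def using assms by (intro measure_pmf.prob_space_distr) simp

lemma two_point_integral:
  fixes f :: "'a \<Rightarrow> real"
  assumes p: "p \<in> {0..1}" and uv: "u \<in> space N" "v \<in> space N" and f: "f \<in> borel_measurable N"
  shows "integrable (two_point N p u v) f"
    and "(\<integral>x. f x \<partial>two_point N p u v) = p * f u + (1 - p) * f v"
proof -
  have m: "(\<lambda>e. if e = 0 then u else v) \<in> measure_pmf (coin p) \<rightarrow>\<^sub>M N" using uv by simp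
  have fin: "finite (set_pmf (coin p))" using set_pmf_coin by (rule finite_subset) simp
  show "integrable (two_point N p u v) f"
    unfolding two_point_def integrable_distr_eq[OF m f] using fin by (rule integrable_measure_pmf_finite)
  have "(\<integral>x. f x \<partial>two_point N p u v) = (\<integral>e. f (if e = 0 then u else v) \<partial>measure_pmf (coin p))"
    unfolding two_point_def integral_distr[OF m f] ..
  also have "\<dots> = (\<Sum>e\<in>{0, 1}. f (if e = 0 then u else v) * pmf (coin p) e)"
    using set_pmf_coin by (intro integral_measure_pmf_real) auto
  also have "\<dots> = p * f u + (1 - p) * f v" using p by (simp add: pmf_coin)
  finally show "(\<integral>x. f x \<partial>two_point N p u v) = p * f u + (1 - p) * f v" .
qed

text \<open>On a box, each side is the product over \<open>k\<close> of the probability that coin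
  \<open>k\<close> selects a point of \<open>A k\<close>, and boxes determine the measure.\<close>

lemma PiM_two_point:
  assumes uv: "\<And>k. k \<in> {1..K} \<Longrightarrow> u k \<in> space (N k)" "\<And>k. k \<in> {1..K} \<Longrightarrow> v k \<in> space (N k)"
  shows "PiM {1..K} (\<lambda>k. two_point (N k) (p k) (u k) (v k)) =
    distr (measure_pmf (Pi_pmf {1..K} undefined (\<lambda>k. coin (p k)))) (PiM {1..K} N) (vertex K u v)"
    (is "?P = ?Q")
proof (rule measure_eqI_PiM_finite)
  let ?I = "{1..K}" and ?T = "\<lambda>k. two_point (N k) (p k) (u k) (v k)"
    and ?C = "Pi_pmf {1..K} undefined (\<lambda>k. coin (p k))"
  have prob: "prob_space (?T k)" if "k \<in> ?I" for k
    using uv that by (intro prob_space_two_point)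
  have vertex: "vertex K u v \<epsilon> \<in> space (PiM ?I N)" for \<epsilon>
    using uv by (auto simp: vertex_def space_PiM)
  show sets: "sets ?P = sets (PiM ?I N)" by (intro sets_PiM_cong) auto
  interpret P: prob_space ?P using prob by (intro prob_space_PiM)
  show "range (\<lambda>_::nat. Pi\<^sub>E ?I (\<lambda>k. space (N k))) \<subseteq> prod_algebra ?I N"
    by (auto intro: prod_algebraI_finite)
  show "emeasure ?P (Pi\<^sub>E ?I (\<lambda>k. space (N k))) \<noteq> \<infinity>"
    using P.emeasure_finite by simp
  fix A assume A: "\<And>k. k \<in> ?I \<Longrightarrow> A k \<in> sets (N k)"
  let ?B = "\<lambda>k. {e. (if e = 0 then u k else v k) \<in> A k}"
  have "prod_emb ?I ?T ?I (Pi\<^sub>E ?I A) = Pi\<^sub>E ?I A"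
    using sets.sets_into_space[OF A] by (intro prod_emb_PiE_same_index) simp
  then have "emeasure ?P (Pi\<^sub>E ?I A) = (\<Prod>k\<in>?I. emeasure (?T k) (A k))"
    using emeasure_PiM_emb[of ?I ?T ?I A] prob A by simp
  also have "\<dots> = (\<Prod>k\<in>?I. emeasure (measure_pmf (coin (p k))) (?B k))"
    using A uv by (intro prod.cong refl) (auto simp: two_point_def emeasure_distr vimage_def)
  also have "\<dots> = emeasure (measure_pmf ?C) (PiE_dflt ?I undefined ?B)"
    by (simp add: measure_pmf.emeasure_eq_measure measure_Pi_pmf_PiE_dflt prod_ennreal)
  \<comment> \<open>\<open>PiE_dflt\<close> also fixes the values off \<open>{1..K}\<close>, which
    the preimage leaves free. The joint coin law charges only functions equal to
    \<open>undefined\<close> there, so the events agree almost surely.\<close>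
  also have "\<dots> = emeasure (measure_pmf ?C) (vertex K u v -` Pi\<^sub>E ?I A)"
    using set_Pi_pmf_subset[of ?I undefined "\<lambda>k. coin (p k)"]
    by (intro emeasure_eq_AE)
      (auto simp: AE_measure_pmf_iff PiE_dflt_def vertex_def PiE_iff split: if_splits)
  also have "\<dots> = emeasure ?Q (Pi\<^sub>E ?I A)"
    using A vertex by (subst emeasure_distr) (auto intro: sets_PiM_I_finite)
  finally show "emeasure ?P (Pi\<^sub>E ?I A) = emeasure ?Q (Pi\<^sub>E ?I A)" .
qed (auto simp: space_PiM)

text \<open>The joint coin law is supported in the finite cube and gives \<open>\<epsilon>\<close>
  the mass \<open>weight K p \<epsilon>\<close>. Applied to a short function this evaluates the
  mean, applied to an indicator the probability.\<close>

lemma PiM_two_point_integral: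
  fixes f :: "(nat \<Rightarrow> 'a) \<Rightarrow> real"
  assumes p: "\<And>k. k \<in> {1..K} \<Longrightarrow> p k \<in> {0..1}"
    and uv: "\<And>k. k \<in> {1..K} \<Longrightarrow> u k \<in> space (N k)" "\<And>k. k \<in> {1..K} \<Longrightarrow> v k \<in> space (N k)"
    and f: "f \<in> borel_measurable (PiM {1..K} N)"
  shows "integrable (PiM {1..K} (\<lambda>k. two_point (N k) (p k) (u k) (v k))) f"
    and "(\<integral>x. f x \<partial>PiM {1..K} (\<lambda>k. two_point (N k) (p k) (u k) (v k))) =
      (\<Sum>\<epsilon>\<in>cube K. weight K p \<epsilon> * f (vertex K u v \<epsilon>))"
proof -
  let ?C = "Pi_pmf {1..K} undefined (\<lambda>k. coin (p k))"
  have vertex: "vertex K u v \<in> measure_pmf ?C \<rightarrow>\<^sub>M PiM {1..K} N"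
    using uv by (auto simp: vertex_def space_PiM)
  have eq: "PiM {1..K} (\<lambda>k. two_point (N k) (p k) (u k) (v k)) = distr (measure_pmf ?C) (PiM {1..K} N) (vertex K u v)"
    using uv by (rule PiM_two_point)
  \<comment> \<open>The default value \<open>undefined\<close> in \<open>Pi_pmf\<close> matches the
    extensionality of the functions in \<open>cube\<close>.\<close>
  have supp: "set_pmf ?C \<subseteq> cube K"
  proof
    fix \<epsilon> assume "\<epsilon> \<in> set_pmf ?C"
    then have "\<forall>k. k \<notin> {1..K} \<longrightarrow> \<epsilon> k = undefined" "(\<Prod>k\<in>{1..K}. pmf (coin (p k)) (\<epsilon> k)) \<noteq> 0"
      by (auto simp: set_pmf_eq pmf_Pi split: if_splits)
    then show "\<epsilon> \<in> cube K"
      using set_pmf_coin by (fastforce simp: cube_def PiE_iff extensional_def set_pmf_eq)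
  qed
  have fin: "finite (cube K)" unfolding cube_def by (intro finite_PiE) auto
  have pmf: "pmf ?C \<epsilon> = weight K p \<epsilon>" if "\<epsilon> \<in> cube K" for \<epsilon>
  proof -
    have "pmf ?C \<epsilon> = (\<Prod>k\<in>{1..K}. pmf (coin (p k)) (\<epsilon> k))"
      using that by (subst pmf_Pi') (auto simp: cube_def PiE_iff extensional_def)
    also have "\<dots> = weight K p \<epsilon>"
      unfolding weight_def
    proof (rule prod.cong[OF refl])
      fix k assume k: "k \<in> {1..K}"
      then have "\<epsilon> k = 0 \<or> \<epsilon> k = 1" using that by (auto simp: cube_def PiE_iff)
      then show "pmf (coin (p k)) (\<epsilon> k) = p k ^ (1 - \<epsilon> k) * (1 - p k) ^ \<epsilon> k"
        by (auto simp: pmf_coin[OF p[OF k]])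
    qed
    finally show ?thesis .
  qed
  show "integrable (PiM {1..K} (\<lambda>k. two_point (N k) (p k) (u k) (v k))) f"
    unfolding eq integrable_distr_eq[OF vertex f]
    using finite_subset[OF supp fin] by (rule integrable_measure_pmf_finite)
  have "(\<integral>x. f x \<partial>PiM {1..K} (\<lambda>k. two_point (N k) (p k) (u k) (v k))) =
      (\<integral>\<epsilon>. f (vertex K u v \<epsilon>) \<partial>measure_pmf ?C)"
    unfolding eq integral_distr[OF vertex f] ..
  also have "\<dots> = (\<Sum>\<epsilon>\<in>cube K. f (vertex K u v \<epsilon>) * pmf ?C \<epsilon>)"
    using supp fin by (intro integral_measure_pmf_real) auto
  also have "\<dots> = (\<Sum>\<epsilon>\<in>cube K. weight K p \<epsilon> * f (vertex K u v \<epsilon>))"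
    by (intro sum.cong refl) (simp only: pmf mult.commute)
  finally show "(\<integral>x. f x \<partial>PiM {1..K} (\<lambda>k. two_point (N k) (p k) (u k) (v k))) =
      (\<Sum>\<epsilon>\<in>cube K. weight K p \<epsilon> * f (vertex K u v \<epsilon>))" .
qed

section \<open>Replacing one factor\<close>

lemma measurable_fun_upd_pair:
  assumes "i \<in> I"
  shows "(\<lambda>(u, x). x(i := u)) \<in> \<mu> i \<Otimes>\<^sub>M PiM (I - {i}) \<mu> \<rightarrow>\<^sub>M PiM I \<mu>"
  unfolding case_prod_beta using assms by (intro measurable_fun_upd[where J = "I - {i}"]) auto

lemma distr_PiM_coordinate:
  assumes "i \<in> I" and "\<forall>k\<in>I. prob_space (\<mu> k)"
  shows "distr (\<mu> i \<Otimes>\<^sub>M PiM (I - {i}) \<mu>) (PiM I \<mu>) (\<lambda>(u, x). x(i := u)) = PiM I \<mu>"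
  using distr_pair_PiM_eq_PiM[of "I - {i}" \<mu> i] assms by (simp add: insert_absorb)

lemma pair_prob_space_PiM:
  assumes "i \<in> I" and "\<forall>k\<in>I. prob_space (\<mu> k)"
  shows "pair_prob_space (\<mu> i) (PiM (I - {i}) \<mu>)"
proof -
  interpret A: prob_space "\<mu> i" using assms by simp
  interpret B: prob_space "PiM (I - {i}) \<mu>" using assms by (intro prob_space_PiM) simp
  show ?thesis ..
qed

text \<open>Fubini's theorem with coordinate \<open>i\<close> outermost, transported along the map
  that inserts \<open>u\<close> at \<open>i\<close>. Sections are integrable only for almost every
  \<open>u\<close>; \<open>short_integrable_section\<close> closes this gap for short
  functions.\<close>

lemma integral_PiM_coordinate:
  fixes f :: "('i \<Rightarrow> 'a) \<Rightarrow> real"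
  assumes i: "i \<in> I" and prob: "\<forall>k\<in>I. prob_space (\<mu> k)" and f: "integrable (PiM I \<mu>) f"
  shows "integrable (\<mu> i) (\<lambda>u. \<integral>x. f (x(i := u)) \<partial>PiM (I - {i}) \<mu>)"
    and "(\<integral>u. (\<integral>x. f (x(i := u)) \<partial>PiM (I - {i}) \<mu>) \<partial>\<mu> i) = (\<integral>x. f x \<partial>PiM I \<mu>)"
    and "AE u in \<mu> i. integrable (PiM (I - {i}) \<mu>) (\<lambda>x. f (x(i := u)))"
proof -
  interpret pair_prob_space "\<mu> i" "PiM (I - {i}) \<mu>" using pair_prob_space_PiM[OF i prob] .
  note m = measurable_fun_upd_pair[OF i, of \<mu>] and d = distr_PiM_coordinate[of i I \<mu>, OF i prob]
  have int: "integrable (\<mu> i \<Otimes>\<^sub>M PiM (I - {i}) \<mu>) (\<lambda>z. f (case z of (u, x) \<Rightarrow> x(i := u)))"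
    using f by (subst integrable_distr_eq[OF m, symmetric]) (auto simp: d)
  show "integrable (\<mu> i) (\<lambda>u. \<integral>x. f (x(i := u)) \<partial>PiM (I - {i}) \<mu>)"
    using integrable_fst'[OF int] by simp
  show "AE u in \<mu> i. integrable (PiM (I - {i}) \<mu>) (\<lambda>x. f (x(i := u)))"
    using AE_integrable_fst'[OF int] by simp
  have "(\<integral>x. f x \<partial>PiM I \<mu>) = (\<integral>z. f (case z of (u, x) \<Rightarrow> x(i := u)) \<partial>(\<mu> i \<Otimes>\<^sub>M PiM (I - {i}) \<mu>))"
    using f by (subst integral_distr[OF m, symmetric]) (auto simp: d)
  then show "(\<integral>u. (\<integral>x. f (x(i := u)) \<partial>PiM (I - {i}) \<mu>) \<partial>\<mu> i) = (\<integral>x. f x \<partial>PiM I \<mu>)"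
    using integral_fst'[OF int] by simp
qed

text \<open>\<open>sections\<close> asks for every \<open>w\<close> because the two points may be
  null for \<open>\<mu> i\<close>, where an almost-everywhere statement gives nothing.\<close>

lemma two_point_coordinate:
  fixes f :: "('i \<Rightarrow> 'a) \<Rightarrow> real"
  assumes i: "i \<in> I" and prob: "\<forall>k\<in>I. prob_space (\<mu> k)"
    and N: "sets N = sets (\<mu> i)" and p: "p \<in> {0..1}" and uv: "u \<in> space N" "v \<in> space N"
    and f: "f \<in> borel_measurable (PiM I \<mu>)"
    and sections: "\<forall>w\<in>space N. integrable (PiM (I - {i}) \<mu>) (\<lambda>x. f (x(i := w)))"
  shows "integrable (PiM I (\<mu>(i := two_point N p u v))) f"
    and "(\<integral>x. f x \<partial>PiM I (\<mu>(i := two_point N p u v))) =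
      p * (\<integral>x. f (x(i := u)) \<partial>PiM (I - {i}) \<mu>) + (1 - p) * (\<integral>x. f (x(i := v)) \<partial>PiM (I - {i}) \<mu>)"
proof -
  let ?\<nu> = "\<mu>(i := two_point N p u v)"
  have prob': "\<forall>k\<in>I. prob_space (?\<nu> k)"
    using prob uv by (auto intro: prob_space_two_point)
  have rest: "PiM (I - {i}) ?\<nu> = PiM (I - {i}) \<mu>" by (intro PiM_cong) auto
  have "sets (PiM I ?\<nu>) = sets (PiM I \<mu>)" using N by (intro sets_PiM_cong) auto
  then have f': "f \<in> borel_measurable (PiM I ?\<nu>)" using f by (simp cong: measurable_cong_sets)
  interpret pair_prob_space "?\<nu> i" "PiM (I - {i}) ?\<nu>" using pair_prob_space_PiM[of i I ?\<nu>, OF i prob'] .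
  note m = measurable_fun_upd_pair[OF i, of ?\<nu>] and d = distr_PiM_coordinate[of i I ?\<nu>, OF i prob']
  have fm: "(\<lambda>z. f (case z of (w, x) \<Rightarrow> x(i := w))) \<in> borel_measurable (?\<nu> i \<Otimes>\<^sub>M PiM (I - {i}) ?\<nu>)"
    using measurable_compose[OF m f'] .
  \<comment> \<open>Used with \<open>norm\<close> for the Fubini integrability criterion and with
    \<open>id\<close> for the value of the integral.\<close>
  have meas: "(\<lambda>w. \<integral>x. g (f (x(i := w))) \<partial>PiM (I - {i}) \<mu>) \<in> borel_measurable N"
    if "g \<in> borel_measurable borel" for g :: "real \<Rightarrow> real"
    using M2.borel_measurable_lebesgue_integral[of "\<lambda>w x. g (f (x(i := w)))" "?\<nu> i"]
      measurable_compose[OF fm that] by (simp add: rest case_prod_beta' cong: measurable_cong_sets)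
  have "integrable (?\<nu> i \<Otimes>\<^sub>M PiM (I - {i}) ?\<nu>) (\<lambda>z. f (case z of (w, x) \<Rightarrow> x(i := w)))"
  proof (rule Fubini_integrable[OF fm])
    show "integrable (?\<nu> i) (\<lambda>w. \<integral>x. norm (f (case (w, x) of (w, x) \<Rightarrow> x(i := w))) \<partial>PiM (I - {i}) ?\<nu>)"
      using two_point_integral(1)[OF p uv meas[of norm]] unfolding rest by simp
    show "AE w in ?\<nu> i. integrable (PiM (I - {i}) ?\<nu>) (\<lambda>x. f (case (w, x) of (w, x) \<Rightarrow> x(i := w)))"
      using sections unfolding rest by (intro AE_I2) simp
  qed
  then show int: "integrable (PiM I ?\<nu>) f"
    using integrable_distr_eq[OF m f'] d by simp
  show "(\<integral>x. f x \<partial>PiM I ?\<nu>) =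
      p * (\<integral>x. f (x(i := u)) \<partial>PiM (I - {i}) \<mu>) + (1 - p) * (\<integral>x. f (x(i := v)) \<partial>PiM (I - {i}) \<mu>)"
    using integral_PiM_coordinate(2)[of i I ?\<nu>, OF i prob' int] two_point_integral(2)[OF p uv meas[of id]]
    unfolding rest by simp
qed

text \<open>By Fubini both integrals are means under \<open>\<mu> i\<close> of section means. Planar
  domination applies to this pair of functions, and the points it yields carry the new
  factor.\<close>

lemma replace_coordinate:
  fixes f h :: "('i \<Rightarrow> 'a) \<Rightarrow> real"
  assumes i: "i \<in> I" and prob: "\<forall>k\<in>I. prob_space (\<mu> k)" and N: "sets N = sets (\<mu> i)"
    and f: "integrable (PiM I \<mu>) f" and h: "integrable (PiM I \<mu>) h"
    and fs: "\<forall>w\<in>space N. integrable (PiM (I - {i}) \<mu>) (\<lambda>x. f (x(i := w)))"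
    and hs: "\<forall>w\<in>space N. integrable (PiM (I - {i}) \<mu>) (\<lambda>x. h (x(i := w)))"
  obtains p u v where "p \<in> {0..1}" "u \<in> space N" "v \<in> space N"
    "integrable (PiM I (\<mu>(i := two_point N p u v))) f"
    "(\<integral>x. f x \<partial>PiM I \<mu>) \<le> (\<integral>x. f x \<partial>PiM I (\<mu>(i := two_point N p u v)))"
    "(\<integral>x. h x \<partial>PiM I \<mu>) \<le> (\<integral>x. h x \<partial>PiM I (\<mu>(i := two_point N p u v)))"
proof -
  interpret prob_space "\<mu> i" using prob i by blast
  note F = integral_PiM_coordinate[of i I \<mu>, OF i prob f] and H = integral_PiM_coordinate[of i I \<mu>, OF i prob h]
  show thesis
  proof (rule two_point_domination[OF F(1) H(1)], unfold F(2) H(2))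
    fix p u v
    assume puv: "p \<in> {0..1}" "u \<in> space (\<mu> i)" "v \<in> space (\<mu> i)"
      and le: "(\<integral>x. f x \<partial>PiM I \<mu>) \<le> p * (\<integral>x. f (x(i := u)) \<partial>PiM (I - {i}) \<mu>)
        + (1 - p) * (\<integral>x. f (x(i := v)) \<partial>PiM (I - {i}) \<mu>)"
      "(\<integral>x. h x \<partial>PiM I \<mu>) \<le> p * (\<integral>x. h (x(i := u)) \<partial>PiM (I - {i}) \<mu>)
        + (1 - p) * (\<integral>x. h (x(i := v)) \<partial>PiM (I - {i}) \<mu>)"
    have uv: "u \<in> space N" "v \<in> space N" using puv sets_eq_imp_space_eq[OF N] by auto
    note tf = two_point_coordinate[of i I \<mu>, OF i prob N puv(1) uv borel_measurable_integrable[OF f] fs]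
    note th = two_point_coordinate[of i I \<mu>, OF i prob N puv(1) uv borel_measurable_integrable[OF h] hs]
    show thesis
      using le unfolding tf(2)[symmetric] th(2)[symmetric] by (rule that[OF puv(1) uv tf(1)])
  qed
qed

section \<open>Reduction to the finite-dimensional problem\<close>

lemma vertex_in_prod_space:
  assumes "x0 \<in> prod_space K X" "x1 \<in> prod_space K X"
  shows "vertex K x0 x1 \<epsilon> \<in> prod_space K X"
  using assms by (auto simp: vertex_def prod_space_def PiE_iff)

lemma dL_fun_upd:
  assumes "i \<in> {1..K}" and "x \<in> (\<Pi>\<^sub>E k\<in>{1..K} - {i}. mspace (X k))"
  shows "dL K X L (x(i := u)) (x(i := w)) = L i * mdist (X i) u w"
proof -
  have "(\<Sum>k\<in>{1..K} - {i}. L k * mdist (X k) ((x(i := u)) k) ((x(i := w)) k)) = 0"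
    using assms(2) by (intro sum.neutral) (auto simp: PiE_iff)
  then show ?thesis
    unfolding dL_def using assms(1) by (subst sum.remove[of _ i]) auto
qed

lemma short_integrable_section:
  assumes g: "dL_short K X L g" and i: "i \<in> {1..K}"
    and prob: "\<forall>k\<in>{1..K}. prob_space (\<nu> k)"
    and space: "\<forall>k\<in>{1..K}. space (\<nu> k) = mspace (X k)"
    and int: "integrable (PiM {1..K} \<nu>) g" and w: "w \<in> mspace (X i)"
  shows "integrable (PiM ({1..K} - {i}) \<nu>) (\<lambda>x. g (x(i := w)))"
proof -
  let ?J = "{1..K} - {i}"
  interpret J: prob_space "PiM ?J \<nu>" using prob by (intro prob_space_PiM) blast
  interpret i: prob_space "\<nu> i" using prob i by blast
  have "\<exists>u\<in>space (\<nu> i). integrable (PiM ?J \<nu>) (\<lambda>x. g (x(i := u)))"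
  proof (rule ccontr)
    assume "\<not> (\<exists>u\<in>space (\<nu> i). integrable (PiM ?J \<nu>) (\<lambda>x. g (x(i := u))))"
    then have none: "\<not> integrable (PiM ?J \<nu>) (\<lambda>x. g (x(i := u)))" if "u \<in> space (\<nu> i)" for u
      using that by blast
    have "AE u in \<nu> i. False"
      using integral_PiM_coordinate(3)[of i "{1..K}" \<nu>, OF i prob int] AE_space
      by eventually_elim (drule none, erule notE)
    then show False by simp
  qed
  then obtain u where u: "u \<in> mspace (X i)" and int_u: "integrable (PiM ?J \<nu>) (\<lambda>x. g (x(i := u)))"
    using space i by auto
  show ?thesis
  proof (rule Bochner_Integration.integrable_bound)
    show "integrable (PiM ?J \<nu>) (\<lambda>x. \<bar>g (x(i := u))\<bar> + \<bar>L i * mdist (X i) u w\<bar>)"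
      using int_u by (intro Bochner_Integration.integrable_add integrable_abs J.integrable_const)
    have "(\<lambda>x. x(i := w)) \<in> PiM ?J \<nu> \<rightarrow>\<^sub>M PiM {1..K} \<nu>"
      using i w space by (intro measurable_fun_upd[where J = ?J]) auto
    then show "(\<lambda>x. g (x(i := w))) \<in> borel_measurable (PiM ?J \<nu>)"
      using borel_measurable_integrable[OF int] by (rule measurable_compose)
    show "AE x in PiM ?J \<nu>. norm (g (x(i := w))) \<le> norm (\<bar>g (x(i := u))\<bar> + \<bar>L i * mdist (X i) u w\<bar>)"
    proof (rule AE_I2)
      fix x assume "x \<in> space (PiM ?J \<nu>)"
      then have x: "x \<in> (\<Pi>\<^sub>E k\<in>?J. mspace (X k))" using space by (auto simp: space_PiM PiE_iff)
      then have upd: "x(i := z) \<in> prod_space K X" if "z \<in> mspace (X i)" for z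
        using i that by (auto simp: prod_space_def PiE_iff extensional_def)
      have "\<bar>g (x(i := u)) - g (x(i := w))\<bar> \<le> L i * mdist (X i) u w"
        using g upd[OF u] upd[OF w] unfolding dL_short_def dL_fun_upd[OF i x, symmetric] by blast
      then show "norm (g (x(i := w))) \<le> norm (\<bar>g (x(i := u))\<bar> + \<bar>L i * mdist (X i) u w\<bar>)"
        by simp
    qed
  qed
qed

text \<open>Factors are replaced one at a time, never decreasing the mean of \<open>g\<close> or
  that of the indicator \<open>h\<close> of \<open>g \<le> \<theta>\<close>. At the end all factors
  are two-point measures and both integrals are sums over the cube.\<close>

lemma two_point_reduction:
  fixes g :: "(nat \<Rightarrow> 'a) \<Rightarrow> real" and X :: "nat \<Rightarrow> 'a metric"
  assumes g: "dL_short K X L g"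
    and \<mu>: "\<forall>k\<in>{1..K}. borel_prob_measure (mtopology_of (X k)) (\<mu> k)"
    and int: "integrable (PiM {1..K} \<mu>) g"
  obtains p u v where "p \<in> (\<Pi>\<^sub>E k\<in>{1..K}. {0..1})" "u \<in> prod_space K X" "v \<in> prod_space K X"
    "(\<integral>x. g x \<partial>PiM {1..K} \<mu>) \<le> (\<Sum>\<epsilon>\<in>cube K. weight K p \<epsilon> * g (vertex K u v \<epsilon>))"
    "measure (PiM {1..K} \<mu>) {x \<in> space (PiM {1..K} \<mu>). g x \<le> \<theta>} \<le>
      (\<Sum>\<epsilon>\<in>cube K. weight K p \<epsilon> * (if g (vertex K u v \<epsilon>) \<le> \<theta> then 1 else 0))"
proof -
  define N where "N k = borel_of (mtopology_of (X k))" for k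
  have spaceN: "space (N k) = mspace (X k)" for k by (simp add: N_def)
  define h :: "(nat \<Rightarrow> 'a) \<Rightarrow> real" where "h x = (if g x \<le> \<theta> then 1 else 0)" for x
  let ?I = "{1..K}"
  \<comment> \<open>Intermediate stage of the induction: factors with index in \<open>S\<close> are
    already two-point measures, the others are the original ones.\<close>
  define mix where "mix S p u v = (\<lambda>k. if k \<in> S then two_point (N k) (p k) (u k) (v k) else \<mu> k)"
    for S and p :: "nat \<Rightarrow> real" and u v
  have prob\<mu>: "prob_space (\<mu> k)" and sets\<mu>: "sets (\<mu> k) = sets (N k)" if "k \<in> ?I" for k
    using \<mu> that by (auto simp: borel_prob_measure_def N_def)
  have mh: "h \<in> borel_measurable M" if [measurable]: "g \<in> borel_measurable M" for M
    unfolding h_def by measurable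
  have step: "\<exists>p u v. (\<forall>k\<in>S. p k \<in> {0..1} \<and> u k \<in> mspace (X k) \<and> v k \<in> mspace (X k))
      \<and> integrable (PiM ?I (mix S p u v)) g
      \<and> (\<integral>x. g x \<partial>PiM ?I \<mu>) \<le> (\<integral>x. g x \<partial>PiM ?I (mix S p u v))
      \<and> (\<integral>x. h x \<partial>PiM ?I \<mu>) \<le> (\<integral>x. h x \<partial>PiM ?I (mix S p u v))"
    if "finite S" "S \<subseteq> ?I" for S
    using that
  proof (induction S rule: finite_induct)
    case empty
    then show ?case using int by (auto simp: mix_def)
  next
    case (insert i S)
    then have i: "i \<in> ?I" by simp
    from insert obtain p u v where S: "\<forall>k\<in>S. p k \<in> {0..1} \<and> u k \<in> mspace (X k) \<and> v k \<in> mspace (X k)"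
      and int_g: "integrable (PiM ?I (mix S p u v)) g"
      and le: "(\<integral>x. g x \<partial>PiM ?I \<mu>) \<le> (\<integral>x. g x \<partial>PiM ?I (mix S p u v))"
        "(\<integral>x. h x \<partial>PiM ?I \<mu>) \<le> (\<integral>x. h x \<partial>PiM ?I (mix S p u v))" by auto
    let ?\<nu> = "mix S p u v"
    have prob: "\<forall>k\<in>?I. prob_space (?\<nu> k)"
      using S prob\<mu> by (auto simp: mix_def spaceN intro!: prob_space_two_point)
    have sets: "sets (?\<nu> k) = sets (N k)" if "k \<in> ?I" for k
      using sets\<mu>[OF that] by (auto simp: mix_def)
    have space: "\<forall>k\<in>?I. space (?\<nu> k) = mspace (X k)"
      using sets_eq_imp_space_eq[OF sets] spaceN by simp
    interpret P: prob_space "PiM ?I ?\<nu>" using prob by (intro prob_space_PiM) blast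
    interpret J: prob_space "PiM (?I - {i}) ?\<nu>" using prob by (intro prob_space_PiM) blast
    \<comment> \<open>Being bounded, \<open>h\<close> is integrable at every stage, whereas
      integrability of \<open>g\<close> is carried through the induction.\<close>
    have int_h: "integrable (PiM ?I ?\<nu>) h"
      using mh[OF borel_measurable_integrable[OF int_g]]
      by (intro P.integrable_const_bound[where B = 1]) (auto simp: h_def)
    have gs: "\<forall>w\<in>space (N i). integrable (PiM (?I - {i}) ?\<nu>) (\<lambda>x. g (x(i := w)))"
      using short_integrable_section[of K X L g i ?\<nu>, OF g i prob space int_g] spaceN by simp
    have hs: "\<forall>w\<in>space (N i). integrable (PiM (?I - {i}) ?\<nu>) (\<lambda>x. h (x(i := w)))"
    proof (intro ballI J.integrable_const_bound[where B = 1])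
      fix w assume "w \<in> space (N i)"
      then have "integrable (PiM (?I - {i}) ?\<nu>) (\<lambda>x. g (x(i := w)))" using gs by blast
      note [measurable] = borel_measurable_integrable[OF this]
      show "(\<lambda>x. h (x(i := w))) \<in> borel_measurable (PiM (?I - {i}) ?\<nu>)"
        unfolding h_def by measurable
    qed (auto simp: h_def)
    obtain p' u' v' where new: "p' \<in> {0..1}" "u' \<in> space (N i)" "v' \<in> space (N i)"
      "integrable (PiM ?I (?\<nu>(i := two_point (N i) p' u' v'))) g"
      "(\<integral>x. g x \<partial>PiM ?I ?\<nu>) \<le> (\<integral>x. g x \<partial>PiM ?I (?\<nu>(i := two_point (N i) p' u' v')))"
      "(\<integral>x. h x \<partial>PiM ?I ?\<nu>) \<le> (\<integral>x. h x \<partial>PiM ?I (?\<nu>(i := two_point (N i) p' u' v')))"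
      by (rule replace_coordinate[of i ?I ?\<nu> "N i" g h, OF i prob sets[OF i, symmetric] int_g int_h gs hs])
    have mix: "?\<nu>(i := two_point (N i) p' u' v') = mix (insert i S) (p(i := p')) (u(i := u')) (v(i := v'))"
      using \<open>i \<notin> S\<close> by (auto simp: mix_def fun_eq_iff)
    show ?case
    proof (intro exI conjI)
      show "\<forall>k\<in>insert i S. (p(i := p')) k \<in> {0..1} \<and> (u(i := u')) k \<in> mspace (X k) \<and> (v(i := v')) k \<in> mspace (X k)"
        using new(1-3) S by (simp add: spaceN)
      show "integrable (PiM ?I (mix (insert i S) (p(i := p')) (u(i := u')) (v(i := v')))) g"
        using new(4) unfolding mix .
      show "(\<integral>x. g x \<partial>PiM ?I \<mu>) \<le> (\<integral>x. g x \<partial>PiM ?I (mix (insert i S) (p(i := p')) (u(i := u')) (v(i := v'))))"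
        using order_trans[OF le(1) new(5)] unfolding mix .
      show "(\<integral>x. h x \<partial>PiM ?I \<mu>) \<le> (\<integral>x. h x \<partial>PiM ?I (mix (insert i S) (p(i := p')) (u(i := u')) (v(i := v'))))"
        using order_trans[OF le(2) new(6)] unfolding mix .
    qed
  qed
  obtain p u v where I: "\<forall>k\<in>?I. p k \<in> {0..1} \<and> u k \<in> mspace (X k) \<and> v k \<in> mspace (X k)"
      and int_mix: "integrable (PiM ?I (mix ?I p u v)) g"
      and le: "(\<integral>x. g x \<partial>PiM ?I \<mu>) \<le> (\<integral>x. g x \<partial>PiM ?I (mix ?I p u v))"
        "(\<integral>x. h x \<partial>PiM ?I \<mu>) \<le> (\<integral>x. h x \<partial>PiM ?I (mix ?I p u v))"
    using step[of ?I] by auto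
  \<comment> \<open>Restriction makes the families extensional, as the feasible set demands;
    \<open>PiM\<close> sees only the indices in \<open>{1..K}\<close>.\<close>
  define p' u' v' where "p' = restrict p ?I" and "u' = restrict u ?I" and "v' = restrict v ?I"
  have PiM_mix: "PiM ?I (mix ?I p u v) = PiM ?I (\<lambda>k. two_point (N k) (p' k) (u' k) (v' k))"
    by (intro PiM_cong) (auto simp: mix_def p'_def u'_def v'_def)
  have sets_mix: "sets (PiM ?I (mix ?I p u v)) = sets (PiM ?I N)"
    by (intro sets_PiM_cong) (auto simp: mix_def)
  have puv: "p' \<in> (\<Pi>\<^sub>E k\<in>?I. {0..1})" "u' \<in> prod_space K X" "v' \<in> prod_space K X"
    using I by (auto simp: p'_def u'_def v'_def prod_space_def)
  then have *: "k \<in> ?I \<Longrightarrow> p' k \<in> {0..1}" "k \<in> ?I \<Longrightarrow> u' k \<in> space (N k)" "k \<in> ?I \<Longrightarrow> v' k \<in> space (N k)" for k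
    unfolding spaceN prod_space_def by blast+
  have eval: "(\<integral>x. f x \<partial>PiM ?I (mix ?I p u v)) = (\<Sum>\<epsilon>\<in>cube K. weight K p' \<epsilon> * f (vertex K u' v' \<epsilon>))"
    if "f \<in> borel_measurable (PiM ?I (mix ?I p u v))" for f
    unfolding PiM_mix using that * sets_mix
    by (intro PiM_two_point_integral(2)) (auto cong: measurable_cong_sets)
  have "(\<integral>x. h x \<partial>PiM ?I \<mu>) = (\<integral>x. indicator {x \<in> space (PiM ?I \<mu>). g x \<le> \<theta>} x \<partial>PiM ?I \<mu>)"
    by (intro Bochner_Integration.integral_cong) (auto simp: h_def)
  also have "\<dots> = measure (PiM ?I \<mu>) {x \<in> space (PiM ?I \<mu>). g x \<le> \<theta>}"
    using borel_measurable_integrable[OF int] by simp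
  finally have h: "(\<integral>x. h x \<partial>PiM ?I \<mu>) = measure (PiM ?I \<mu>) {x \<in> space (PiM ?I \<mu>). g x \<le> \<theta>}" .
  note mg = borel_measurable_integrable[OF int_mix]
  show thesis
    using le unfolding h eval[OF mg] eval[OF mh[OF mg]] by (intro that[OF puv]) (simp_all add: h_def)
qed

text \<open>The constraints on \<open>y\<close> make the vertices, joined to the observations,
  compatible nodes for a McShane extension. Integrals over the product of two-point measures then
  reproduce the sums over the cube.\<close>

lemma prob_feasible_realization:
  assumes L: "\<forall>k\<in>{1..K}. L k \<ge> 0"
    and sep: "\<forall>k\<in>{1..K}. separable_space (mtopology_of (X k))"
    and Obs: "Obs \<subseteq> prod_space K X" and G: "dL_short K X L G"
    and feas: "(x0, x1, y, p) \<in> prob_feasible K X L G m Obs"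
  obtains g \<mu> where "(g, \<mu>) \<in> Phat_admissible K X L G m Obs"
    "measure (PiM {1..K} \<mu>) {x \<in> space (PiM {1..K} \<mu>). g x \<le> \<theta>} = prob_objective K \<theta> (x0, x1, y, p)"
proof -
  define N where "N k = borel_of (mtopology_of (X k))" for k
  define \<mu> where "\<mu> k = two_point (N k) (p k) (x0 k) (x1 k)" for k
  let ?V = "vertex K x0 x1" and ?I = "{1..K}"
  from feas have x: "x0 \<in> prod_space K X" "x1 \<in> prod_space K X" and p: "p \<in> (\<Pi>\<^sub>E k\<in>{1..K}. {0..1})"
    and yy: "\<And>\<epsilon> \<epsilon>'. \<epsilon> \<in> cube K \<Longrightarrow> \<epsilon>' \<in> cube K \<Longrightarrow> \<epsilon> \<noteq> \<epsilon>' \<Longrightarrow> \<bar>y \<epsilon> - y \<epsilon>'\<bar> \<le> dL K X L (?V \<epsilon>) (?V \<epsilon>')"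
    and yz: "\<And>\<epsilon> z. \<epsilon> \<in> cube K \<Longrightarrow> z \<in> Obs \<Longrightarrow> \<bar>y \<epsilon> - G z\<bar> \<le> dL K X L (?V \<epsilon>) z"
    and mean: "(\<Sum>\<epsilon>\<in>cube K. weight K p \<epsilon> * y \<epsilon>) \<ge> m"
    by (auto simp: prob_feasible_def)
  have V: "?V \<epsilon> \<in> prod_space K X" for \<epsilon> using x by (rule vertex_in_prod_space)
  \<comment> \<open>Several \<open>\<epsilon>\<close> may give the same vertex, and a vertex may be
    an observation; hence a set of pairs.\<close>
  define J where "J = (\<lambda>z. (z, G z)) ` Obs \<union> (\<lambda>\<epsilon>. (?V \<epsilon>, y \<epsilon>)) ` cube K"
  have "cube K \<noteq> {}" by (auto simp: cube_def PiE_eq_empty_iff)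
  then have J: "J \<noteq> {}" by (simp add: J_def)
  have JX: "s \<in> prod_space K X" if "(s, v) \<in> J" for s v
    using that Obs V by (auto simp: J_def)
  have compat: "v - w \<le> dL K X L s t" if "(s, v) \<in> J" "(t, w) \<in> J" for s v t w
  proof -
    \<comment> \<open>Feasibility speaks of distinct indices; the diagonal case is nonnegativity of
      \<open>dL\<close>.\<close>
    have "\<bar>y \<epsilon> - y \<epsilon>'\<bar> \<le> dL K X L (?V \<epsilon>) (?V \<epsilon>')" if "\<epsilon> \<in> cube K" "\<epsilon>' \<in> cube K" for \<epsilon> \<epsilon>'
      using yy[OF that] dL_nonneg[OF L] by (cases "\<epsilon> = \<epsilon>'") auto
    moreover have "\<bar>G z - G z'\<bar> \<le> dL K X L z z'" if "z \<in> Obs" "z' \<in> Obs" for z z'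
      using G Obs that by (auto simp: dL_short_def)
    moreover have "\<bar>G z - y \<epsilon>\<bar> \<le> dL K X L z (?V \<epsilon>)" if "\<epsilon> \<in> cube K" "z \<in> Obs" for \<epsilon> z
      using yz[OF that] by (subst dL_commute) linarith
    ultimately have "\<bar>v - w\<bar> \<le> dL K X L s t" using that yz by (auto simp: J_def)
    then show ?thesis by linarith
  qed
  have "\<exists>g. dL_short K X L g \<and> (\<forall>(s, v)\<in>J. g s = v)"
    using L J JX compat by (rule McShane_extension)
  then obtain g where short: "dL_short K X L g" and "\<forall>(s, v)\<in>J. g s = v"
    by blast
  then have ext: "g s = v" if "(s, v) \<in> J" for s v using that by auto
  have gz: "g z = G z" if "z \<in> Obs" for z using ext that by (auto simp: J_def)
  have gV: "g (?V \<epsilon>) = y \<epsilon>" if "\<epsilon> \<in> cube K" for \<epsilon> using ext that by (auto simp: J_def)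
  have g: "g \<in> borel_measurable (PiM ?I N)"
    unfolding N_def using L sep short by (rule dL_short_measurable)
  have "sets (PiM ?I \<mu>) = sets (PiM ?I N)" unfolding \<mu>_def by (intro sets_PiM_cong) auto
  then have g': "g \<in> borel_measurable (PiM ?I \<mu>)" using g by (simp cong: measurable_cong_sets)
  have pk: "p k \<in> {0..1}" and xk: "x0 k \<in> space (N k)" "x1 k \<in> space (N k)" if "k \<in> ?I" for k
    using p x that unfolding prod_space_def N_def space_borel_of topspace_mtopology_of by blast+
  have integral: "integrable (PiM ?I \<mu>) f"
    "(\<integral>x. f x \<partial>PiM ?I \<mu>) = (\<Sum>\<epsilon>\<in>cube K. weight K p \<epsilon> * f (?V \<epsilon>))"
    if "f \<in> borel_measurable (PiM ?I N)" for f
    using PiM_two_point_integral[of K p x0 N x1 f] pk xk that unfolding \<mu>_def by blast+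
  have "borel_prob_measure (mtopology_of (X k)) (\<mu> k)" if "k \<in> ?I" for k
    using prob_space_two_point[OF xk[OF that]] by (simp add: borel_prob_measure_def \<mu>_def N_def)
  moreover have "(\<integral>x. g x \<partial>PiM ?I \<mu>) \<ge> m"
    unfolding integral(2)[OF g] using mean gV by simp
  ultimately have adm: "(g, \<mu>) \<in> Phat_admissible K X L G m Obs"
    using short gz integral(1)[OF g] by (auto simp: Phat_admissible_def)
  let ?h = "\<lambda>x. if g x \<le> \<theta> then 1 else 0 :: real"
  have "measure (PiM ?I \<mu>) {x \<in> space (PiM ?I \<mu>). g x \<le> \<theta>} =
      (\<integral>x. indicator {x \<in> space (PiM ?I \<mu>). g x \<le> \<theta>} x \<partial>PiM ?I \<mu>)"
    using g' by simp
  also have "\<dots> = (\<integral>x. ?h x \<partial>PiM ?I \<mu>)"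
    by (intro Bochner_Integration.integral_cong) auto
  also have "\<dots> = (\<Sum>\<epsilon>\<in>cube K. weight K p \<epsilon> * ?h (?V \<epsilon>))"
    using g by (intro integral(2)) measurable
  also have "\<dots> = prob_objective K \<theta> (x0, x1, y, p)"
    unfolding prob_objective_def using gV by simp
  finally show thesis by (rule that[OF adm])
qed

text \<open>Two-point replacement turns an admissible pair into a feasible point of at least the
  same objective; McShane extension turns a feasible point into a pair of equal objective.\<close>

lemma Phat_eq_SUP_prob_feasible:
  assumes L: "\<forall>k\<in>{1..K}. L k \<ge> 0"
    and sep: "\<forall>k\<in>{1..K}. separable_space (mtopology_of (X k))"
    and Obs: "Obs \<subseteq> prod_space K X" and G: "dL_short K X L G"
  shows "Phat K X L G m \<theta> Obs = (SUP q\<in>prob_feasible K X L G m Obs. ereal (prob_objective K \<theta> q))"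
proof (rule antisym)
  show "Phat K X L G m \<theta> Obs \<le> (SUP q\<in>prob_feasible K X L G m Obs. ereal (prob_objective K \<theta> q))"
    unfolding Phat_def
  proof (rule SUP_least, clarify)
    fix g \<mu> assume "(g, \<mu>) \<in> Phat_admissible K X L G m Obs"
    then have short: "dL_short K X L g" and gz: "\<And>z. z \<in> Obs \<Longrightarrow> g z = G z"
      and \<mu>: "\<forall>k\<in>{1..K}. borel_prob_measure (mtopology_of (X k)) (\<mu> k)"
      and int: "integrable (PiM {1..K} \<mu>) g" and mean: "(\<integral>x. g x \<partial>PiM {1..K} \<mu>) \<ge> m"
      by (auto simp: Phat_admissible_def)
    obtain p u v where puv: "p \<in> (\<Pi>\<^sub>E k\<in>{1..K}. {0..1})" "u \<in> prod_space K X" "v \<in> prod_space K X"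
      and le: "(\<integral>x. g x \<partial>PiM {1..K} \<mu>) \<le> (\<Sum>\<epsilon>\<in>cube K. weight K p \<epsilon> * g (vertex K u v \<epsilon>))"
        "measure (PiM {1..K} \<mu>) {x \<in> space (PiM {1..K} \<mu>). g x \<le> \<theta>} \<le>
          (\<Sum>\<epsilon>\<in>cube K. weight K p \<epsilon> * (if g (vertex K u v \<epsilon>) \<le> \<theta> then 1 else 0))"
      using two_point_reduction[of K X L g \<mu> \<theta>, OF short \<mu> int] .
    \<comment> \<open>With \<open>y\<close> the values of \<open>g\<close> at the vertices, all
      distance constraints are instances of shortness, those for observations because
      \<open>g\<close> agrees with \<open>G\<close> there.\<close>
    let ?q = "(u, v, \<lambda>\<epsilon>. g (vertex K u v \<epsilon>), p)"
    have "\<bar>g (vertex K u v \<epsilon>) - g x\<bar> \<le> dL K X L (vertex K u v \<epsilon>) x" if "x \<in> prod_space K X" for \<epsilon> x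
      using short vertex_in_prod_space[OF puv(2,3)] that by (auto simp: dL_short_def)
    then have "?q \<in> prob_feasible K X L G m Obs"
      using puv vertex_in_prod_space[OF puv(2,3)] gz Obs mean le(1)
      by (auto simp: prob_feasible_def simp flip: gz)
    moreover have "measure (PiM {1..K} \<mu>) {x \<in> space (PiM {1..K} \<mu>). g x \<le> \<theta>} \<le> prob_objective K \<theta> ?q"
      using le(2) by (simp add: prob_objective_def)
    ultimately show "ereal (measure (PiM {1..K} \<mu>) {x \<in> space (PiM {1..K} \<mu>). g x \<le> \<theta>}) \<le>
        (SUP q\<in>prob_feasible K X L G m Obs. ereal (prob_objective K \<theta> q))"
      by (intro SUP_upper2) auto
  qed
  show "(SUP q\<in>prob_feasible K X L G m Obs. ereal (prob_objective K \<theta> q)) \<le> Phat K X L G m \<theta> Obs"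
  proof (rule SUP_least, clarify)
    fix x0 x1 y p assume "(x0, x1, y, p) \<in> prob_feasible K X L G m Obs"
    from prob_feasible_realization[OF L sep Obs G this] obtain g \<mu> where
      "(g, \<mu>) \<in> Phat_admissible K X L G m Obs"
      "measure (PiM {1..K} \<mu>) {x \<in> space (PiM {1..K} \<mu>). g x \<le> \<theta>} = prob_objective K \<theta> (x0, x1, y, p)" .
    then show "ereal (prob_objective K \<theta> (x0, x1, y, p)) \<le> Phat K X L G m \<theta> Obs"
      unfolding Phat_def by (intro SUP_upper2[of "(g, \<mu>)"]) auto
  qed
qed

section \<open>Non-binding observations\<close>

text \<open>The value at \<open>q\<close> is an upper bound over \<open>A\<close> and is attained in
  \<open>B\<close>. Here \<open>B\<close> is the feasible set after \<open>z0\<close> has been added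
  to the observations.\<close>

lemma SUP_subset_eq_if_arg_max:
  fixes f :: "'q \<Rightarrow> real"
  assumes "is_arg_max f (\<lambda>q. q \<in> A) q" "q \<in> B" "B \<subseteq> A"
  shows "(SUP q\<in>B. ereal (f q)) = (SUP q\<in>A. ereal (f q))"
proof (rule antisym)
  show "(SUP q\<in>B. ereal (f q)) \<le> (SUP q\<in>A. ereal (f q))"
    using \<open>B \<subseteq> A\<close> by (rule SUP_subset_mono) simp
  have "ereal (f a) \<le> ereal (f q)" if "a \<in> A" for a
    using assms(1) that by (auto simp: is_arg_max_def not_less)
  then show "(SUP q\<in>A. ereal (f q)) \<le> (SUP q\<in>B. ereal (f q))"
    using \<open>q \<in> B\<close> by (meson SUP_least SUP_upper2)
qed

theorem proposition5p4:
  fixes K :: nat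
    and X :: "nat \<Rightarrow> 'a metric"
    and L :: "nat \<Rightarrow> real"
    and Obs :: "(nat \<Rightarrow> 'a) set"
    and z0 :: "nat \<Rightarrow> 'a"
    and G :: "(nat \<Rightarrow> 'a) \<Rightarrow> real"
    and m \<theta> :: real
  assumes "K \<ge> 1"
    and "\<And>k. k \<in> {1..K} \<Longrightarrow> Radon_space (mtopology_of (X k))"
    and "\<And>k. k \<in> {1..K} \<Longrightarrow> L k \<ge> 0"
    and "Obs \<subseteq> prod_space K X"
    and "z0 \<in> prod_space K X"
    and "dL_short K X L G"
  shows
    "(\<forall>k\<in>{1..K}. \<forall>x y x' y'.
        is_arg_max diam_objective (\<lambda>q. q \<in> diam_feasible K X L G k Obs) (x, y, x', y') \<longrightarrow>
        \<bar>y - G z0\<bar> \<le> dL K X L x z0 \<longrightarrow> \<bar>y' - G z0\<bar> \<le> dL K X L x' z0 \<longrightarrow>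
        Dhat K X L G k (Obs \<union> {z0}) = Dhat K X L G k Obs)
     \<and>
     (\<forall>x0 x1 y p.
        is_arg_max (prob_objective K \<theta>) (\<lambda>q. q \<in> prob_feasible K X L G m Obs) (x0, x1, y, p) \<longrightarrow>
        (\<forall>\<epsilon>\<in>cube K. \<bar>y \<epsilon> - G z0\<bar> \<le> dL K X L (vertex K x0 x1 \<epsilon>) z0) \<longrightarrow>
        Phat K X L G m \<theta> (Obs \<union> {z0}) = Phat K X L G m \<theta> Obs)"
proof (intro conjI ballI allI impI)
  fix k x y x' y'
  assume "k \<in> {1..K}"
    and max: "is_arg_max diam_objective (\<lambda>q. q \<in> diam_feasible K X L G k Obs) (x, y, x', y')"
    and z0: "\<bar>y - G z0\<bar> \<le> dL K X L x z0" "\<bar>y' - G z0\<bar> \<le> dL K X L x' z0"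
  have "(x, y, x', y') \<in> diam_feasible K X L G k (Obs \<union> {z0})"
    using max z0 by (auto simp: is_arg_max_def diam_feasible_def)
  then show "Dhat K X L G k (Obs \<union> {z0}) = Dhat K X L G k Obs"
    unfolding Dhat_def by (rule SUP_subset_eq_if_arg_max[OF max]) (auto simp: diam_feasible_def)
next
  fix x0 x1 y p
  assume max: "is_arg_max (prob_objective K \<theta>) (\<lambda>q. q \<in> prob_feasible K X L G m Obs) (x0, x1, y, p)"
    and z0: "\<forall>\<epsilon>\<in>cube K. \<bar>y \<epsilon> - G z0\<bar> \<le> dL K X L (vertex K x0 x1 \<epsilon>) z0"
  have L: "\<forall>k\<in>{1..K}. L k \<ge> 0" and sep: "\<forall>k\<in>{1..K}. separable_space (mtopology_of (X k))"
    using assms(2,3) by (auto simp: Radon_space_def)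
  have "Obs \<union> {z0} \<subseteq> prod_space K X" using assms(4,5) by simp
  \<comment> \<open>With both sides rewritten as suprema over feasible points, the argument of the
    diameter case applies.\<close>
  note eq = Phat_eq_SUP_prob_feasible[OF L sep this assms(6)]
    Phat_eq_SUP_prob_feasible[OF L sep assms(4,6)]
  have "(x0, x1, y, p) \<in> prob_feasible K X L G m (Obs \<union> {z0})"
    using max z0 by (auto simp: is_arg_max_def prob_feasible_def)
  then show "Phat K X L G m \<theta> (Obs \<union> {z0}) = Phat K X L G m \<theta> Obs"
    unfolding eq by (rule SUP_subset_eq_if_arg_max[OF max]) (auto simp: prob_feasible_def)
qed

end
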